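(* The SOS volume function $f^{\mathrm{sos}}:\mathrm{PD}_M\to(0,\infty)$, $f^{\mathrm{sos}}(G)=\mathrm{vol}\left(\{\mathbf{x}\in\mathbb{R}^n:\mathbf{m}_{d/2}(\mathbf{x})^{\mathsf T}G\,\mathbf{m}_{d/2}(\mathbf{x})\le 1\}\right)$, admits the integral representation $$f^{\mathrm{sos}}(G)=\int_{\mathrm{PSD}_M}\exp(-\mathrm{Tr}(\Theta\,G))\,\frac{\mathrm{d}\mu^{\mathrm{sos}}(\Theta)}{\Gamma(1+n/d)},\qquad G\in\mathrm{PD}_M,$$ where $\mu^{\mathrm{sos}}$ is the push-forward of the Lebesgue measure on $\mathbb{R}^n$ under the map $\boldsymbol{\Theta}^{\mathrm{sos}}_{d,n}:\mathbb{R}^n\to\mathrm{PSD}_M$, $\boldsymbol{\ell}\mapsto\mathbf{m}_{d/2}(\boldsymbol{\ell})\,\mathbf{m}_{d/2}(\boldsymbol{\ell})^{\mathsf T}$.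
   Context: $n$ is a positive integer and $d\ge 2$ is even. $\mathbf{m}_{d/2}(\mathbf{x})=(\mathbf{x}^{\alpha})_{|\alpha|=d/2}$ is the column vector of all monomials of degree $d/2$ in $\mathbf{x}=(x_1,\dots,x_n)$ (in a fixed order), of length $M=\binom{d/2+n-1}{n-1}$. $\mathrm{PD}_M$ and $\mathrm{PSD}_M$ are the convex cones of positive definite, respectively positive semi-definite, real symmetric $M\times M$ matrices. $\mathrm{vol}$ is the Lebesgue volume on $\mathbb{R}^n$. *)

theory Defs
  imports "HOL-Analysis.Analysis" "HOL-Library.Multiset"
begin

definition exponents :: "nat \<Rightarrow> ('n::finite \<Rightarrow> nat) set" where
  "exponents k = {\<alpha>. (\<Sum>i\<in>UNIV. \<alpha> i) = k}"

text \<open>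
  The number \<open>M\<close> of monomials is the cardinality of an index type \<open>'m\<close>: a fixed order of the
  monomials of degree \<open>k\<close> is a bijection \<open>e\<close> from \<open>'m\<close> onto the exponents of degree \<open>k\<close>, so that
  \<open>M \<times> M\<close> matrices are elements of \<open>real ^ 'm ^ 'm\<close>.
\<close>

definition monomial_order :: "nat \<Rightarrow> ('m::finite \<Rightarrow> 'n::finite \<Rightarrow> nat) \<Rightarrow> bool" where
  "monomial_order k e \<longleftrightarrow> bij_betw e UNIV (exponents k)"

lemma card_exponents:
  "card (exponents k :: ('n::finite \<Rightarrow> nat) set) = (k + CARD('n) - 1) choose (CARD('n) - 1)"
proof -
  have size: "size X = (\<Sum>i\<in>UNIV. count X i)" for X :: "'n multiset"
    unfolding size_multiset_overloaded_eq
    by (rule sum.mono_neutral_left) (auto simp: count_eq_zero_iff)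
  have "bij_betw count (multisets_of_size (UNIV :: 'n set) k) (exponents k)"
    by (rule bij_betwI[where g = Abs_multiset])
      (auto simp: exponents_def multisets_of_size_def size count_Abs_multiset count_inverse)
  then have "card (exponents k :: ('n \<Rightarrow> nat) set) = (CARD('n) + k - 1) choose k"
    by (metis bij_betw_same_card card_multisets_of_size finite)
  also have "\<dots> = (k + CARD('n) - 1) choose (CARD('n) - 1)"
  proof -
    have "1 \<le> CARD('n)"
      by (simp add: Suc_le_eq)
    then have "k \<le> k + CARD('n) - 1" and "k + CARD('n) - 1 - k = CARD('n) - 1"
      by arith+
    then show ?thesis
      using binomial_symmetric[of k "k + CARD('n) - 1"] by (simp only: add.commute)
  qed
  finally show ?thesis .
qed

lemma monomial_order_card:
  fixes e :: "'m::finite \<Rightarrow> 'n::finite \<Rightarrow> nat"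
  assumes "monomial_order k e"
  shows "CARD('m) = (k + CARD('n) - 1) choose (CARD('n) - 1)"
  using assms bij_betw_same_card[of e UNIV "exponents k"]
  by (simp add: monomial_order_def card_exponents)

definition mon_vec :: "('m::finite \<Rightarrow> 'n::finite \<Rightarrow> nat) \<Rightarrow> real ^ 'n \<Rightarrow> real ^ 'm" where
  "mon_vec e x = (\<chi> j. \<Prod>i\<in>UNIV. (x $ i) ^ e j i)"

definition PD :: "(real ^ 'm ^ 'm) set" where
  "PD = {A. transpose A = A \<and> (\<forall>v. v \<noteq> 0 \<longrightarrow> v \<bullet> (A *v v) > 0)}"

definition PSD :: "(real ^ 'm ^ 'm) set" where
  "PSD = {A. transpose A = A \<and> (\<forall>v. v \<bullet> (A *v v) \<ge> 0)}"

definition sos_sublevel ::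
    "('m::finite \<Rightarrow> 'n::finite \<Rightarrow> nat) \<Rightarrow> real ^ 'm ^ 'm \<Rightarrow> (real ^ 'n) set" where
  "sos_sublevel e G = {x. mon_vec e x \<bullet> (G *v mon_vec e x) \<le> 1}"

definition f_sos :: "('m::finite \<Rightarrow> 'n::finite \<Rightarrow> nat) \<Rightarrow> real ^ 'm ^ 'm \<Rightarrow> real" where
  "f_sos e G = measure lborel (sos_sublevel e G)"

definition Theta_sos ::
    "('m::finite \<Rightarrow> 'n::finite \<Rightarrow> nat) \<Rightarrow> real ^ 'n \<Rightarrow> real ^ 'm ^ 'm" where
  "Theta_sos e l = (\<chi> i j. mon_vec e l $ i * mon_vec e l $ j)"

text \<open>
  The push-forward is a measure on the cone \<open>PSD\<close> with its Borel sets, so integrals with respect to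
  it range over \<open>PSD\<close>.
\<close>

definition mu_sos :: "('m::finite \<Rightarrow> 'n::finite \<Rightarrow> nat) \<Rightarrow> (real ^ 'm ^ 'm) measure" where
  "mu_sos e = distr lborel (restrict_space borel PSD) (Theta_sos e)"

lemma space_mu_sos: "space (mu_sos e) = PSD"
  by (simp add: mu_sos_def space_restrict_space)

lemma Theta_sos_in_PSD: "Theta_sos e l \<in> PSD"
proof -
  have "v \<bullet> (Theta_sos e l *v v) = (v \<bullet> mon_vec e l)\<^sup>2" for v
    by (simp add: Theta_sos_def inner_vec_def matrix_vector_mult_def power2_eq_square
        sum_product sum_distrib_left mult_ac)
  moreover have "transpose (Theta_sos e l) = Theta_sos e l"
    by (simp add: Theta_sos_def transpose_def vec_eq_iff mult.commute)
  ultimately show ?thesis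
    by (simp add: PSD_def)
qed

lemma measurable_Theta_sos: "Theta_sos e \<in> lborel \<rightarrow>\<^sub>M restrict_space borel PSD"
proof (rule measurable_restrict_space2)
  have "continuous_on UNIV (Theta_sos e)"
    unfolding Theta_sos_def mon_vec_def by (auto intro!: continuous_intros)
  then show "Theta_sos e \<in> lborel \<rightarrow>\<^sub>M borel"
    by (simp add: borel_measurable_continuous_onI)
qed (simp add: Theta_sos_in_PSD)

end

theory Submission
  imports Defs
begin

text \<open>
  Both sides reduce to \<open>\<integral> exp (- p x) dx\<close> for the form \<open>p x = m(x)\<^sup>T G m(x)\<close>: the right-hand side by
  \<open>trace (m(x) m(x)\<^sup>T G) = p x\<close>, and the left-hand side by integrating over levels,
  \<open>\<integral> exp (- p x) dx = \<integral>\<^sub>0\<^sup>\<infinity> exp (- t) vol {p \<le> t} dt\<close> with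
  \<open>vol {p \<le> t} = t powr (n / d) vol {p \<le> 1}\<close> by homogeneity. Since \<open>p\<close> is positive on the
  unit sphere, which is compact, \<open>{p \<le> 1}\<close> is bounded.
\<close>

text \<open>Change of variables for the dilation by \<open>c\<close>, whose Jacobian is
  \<open>c ^ DIM('a)\<close>. The preimage form suits sublevel sets, where homogeneity rewrites the
  condition on \<open>c *\<^sub>R x\<close>.\<close>

lemma emeasure_lborel_scaleR_vimage:
  fixes A :: "'a::euclidean_space set"
  assumes "A \<in> sets borel" and "c > 0"
  shows "emeasure lborel A = ennreal (c ^ DIM('a)) * emeasure lborel {x. c *\<^sub>R x \<in> A}"
proof -
  have "emeasure lborel A =
      emeasure (density (distr lborel borel (\<lambda>x. 0 + c *\<^sub>R x)) (\<lambda>_. ennreal (\<bar>c\<bar> ^ DIM('a)))) A"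
    using lborel_affine[of c "0 :: 'a"] assms by simp
  then show ?thesis
    using assms by (simp add: emeasure_density_const emeasure_distr vimage_def)
qed

lemma emeasure_lborel_sublevel_homogeneous:
  fixes p :: "'a::euclidean_space \<Rightarrow> real"
  assumes [measurable]: "p \<in> borel_measurable borel"
    and hom: "\<And>c x. p (c *\<^sub>R x) = c ^ d * p x"
    and "d > 0" and "t > 0"
  shows "emeasure lborel {x. p x \<le> t} =
    ennreal (t powr (real DIM('a) / real d)) * emeasure lborel {x. p x \<le> 1}"
proof -
  \<comment> \<open>Chosen so that \<open>c ^ d = t\<close>: then
    \<open>p (c *\<^sub>R x) \<le> t\<close> reads \<open>t * p x \<le> t\<close>, and
    \<open>t\<close> cancels.\<close>
  define c where "c = t powr (1 / real d)"
  have "c > 0" using \<open>t > 0\<close> by (simp add: c_def)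
  have cd: "c ^ d = t" and cn: "c ^ DIM('a) = t powr (real DIM('a) / real d)"
    using \<open>t > 0\<close> \<open>d > 0\<close> by (simp_all add: c_def powr_power)
  have "{x. c *\<^sub>R x \<in> {x. p x \<le> t}} = {x. p x \<le> 1}"
    using \<open>t > 0\<close> by (simp add: hom cd)
  moreover have "{x. p x \<le> t} \<in> sets borel" by measurable
  ultimately show ?thesis
    using emeasure_lborel_scaleR_vimage[of "{x. p x \<le> t}" c] \<open>c > 0\<close> cn by simp
qed

text \<open>Layer-cake form of the exponential: with \<open>a = p x\<close> it brings in the level
  \<open>t\<close> as a second variable of integration, ready for an interchange.\<close>

lemma nn_integral_exp_minus_atLeast:
  "(\<integral>\<^sup>+t. ennreal (exp (- t)) * indicator {a..} t \<partial>lborel) = ennreal (exp (- a))"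
proof -
  have "(\<integral>\<^sup>+t. ennreal (exp (- t)) * indicator {a..} t \<partial>lborel) = ennreal (0 - (- exp (- a)))"
  proof (rule nn_integral_FTC_atLeast)
    show "((\<lambda>t::real. - exp (- t)) \<longlongrightarrow> 0) at_top"
      using tendsto_minus[OF filterlim_compose[OF exp_at_bot filterlim_uminus_at_bot_at_top]]
      by simp
  qed (auto intro!: derivative_eq_intros)
  then show ?thesis by simp
qed

lemma nn_integral_exp_minus_homogeneous:
  fixes p :: "'a::euclidean_space \<Rightarrow> real"
  assumes p [measurable]: "p \<in> borel_measurable borel"
    and hom: "\<And>c x. p (c *\<^sub>R x) = c ^ d * p x"
    and nonneg: "\<And>x. 0 \<le> p x"
    and "d > 0"
  shows "(\<integral>\<^sup>+x. ennreal (exp (- p x)) \<partial>lborel) =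
    ennreal (Gamma (1 + real DIM('a) / real d)) * emeasure lborel {x. p x \<le> 1}"
proof -
  let ?s = "real DIM('a) / real d"
  let ?V = "emeasure lborel {x. p x \<le> 1}"
  have "(\<integral>\<^sup>+x. ennreal (exp (- p x)) \<partial>lborel) =
      (\<integral>\<^sup>+x. \<integral>\<^sup>+t. ennreal (exp (- t)) * indicator {p x..} t \<partial>lborel \<partial>lborel)"
    by (simp add: nn_integral_exp_minus_atLeast)
  also have "\<dots> = (\<integral>\<^sup>+t. \<integral>\<^sup>+x. ennreal (exp (- t)) * indicator {p x..} t \<partial>lborel \<partial>lborel)"
    by (rule lborel_pair.Fubini') (simp add: split_beta' indicator_def)
  also have "\<dots> = (\<integral>\<^sup>+t. ennreal (exp (- t)) * emeasure lborel {x. p x \<le> t} \<partial>lborel)"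
  proof (rule nn_integral_cong)
    fix t :: real
    have "(\<integral>\<^sup>+x. ennreal (exp (- t)) * indicator {p x..} t \<partial>lborel) =
        (\<integral>\<^sup>+x. ennreal (exp (- t)) * indicator {x. p x \<le> t} x \<partial>lborel)"
      by (simp add: indicator_def)
    then show "(\<integral>\<^sup>+x. ennreal (exp (- t)) * indicator {p x..} t \<partial>lborel) =
        ennreal (exp (- t)) * emeasure lborel {x. p x \<le> t}"
      by (simp add: nn_integral_cmult_indicator)
  qed
  \<comment> \<open>The integrands are compared off \<open>t = 0\<close> only: there
    \<open>0 powr ?s = 0\<close>, while \<open>{x. p x \<le> 0}\<close> may have positive measure.
    For \<open>t > 0\<close> the scaling law applies, and for \<open>t < 0\<close> both sides
    vanish.\<close>
  also have "\<dots> = (\<integral>\<^sup>+t. ennreal (indicator {0..} t * t powr ?s / exp t) * ?V \<partial>lborel)"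
  proof (rule nn_integral_cong_AE)
    have "AE t in lborel. t \<noteq> (0::real)" by (rule AE_lborel_singleton)
    then show "AE t in lborel. ennreal (exp (- t)) * emeasure lborel {x. p x \<le> t} =
        ennreal (indicator {0..} t * t powr ?s / exp t) * ?V"
    proof eventually_elim
      case (elim t)
      show ?case
      proof (cases "t > 0")
        case True
        then have "ennreal (exp (- t)) * emeasure lborel {x. p x \<le> t} =
            ennreal (exp (- t)) * ennreal (t powr ?s) * ?V"
          by (subst emeasure_lborel_sublevel_homogeneous[OF p hom \<open>d > 0\<close>])
            (simp_all add: mult.assoc)
        also have "ennreal (exp (- t)) * ennreal (t powr ?s) = ennreal (exp (- t) * t powr ?s)"
          by (rule ennreal_mult'[symmetric]) simp
        also have "exp (- t) * t powr ?s = indicator {0..} t * t powr ?s / exp t"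
          using True by (simp add: exp_minus divide_inverse)
        finally show ?thesis .
      next
        case False
        then have "t < 0"
          using elim by simp
        then have "{x. p x \<le> t} = {}"
          using nonneg by (auto simp: not_le intro: less_le_trans)
        then show ?thesis
          using \<open>t < 0\<close> by simp
      qed
    qed
  qed
  \<comment> \<open>The factor \<open>?V\<close>, possibly infinite here, does not depend on
    \<open>t\<close>; what is left is Euler's integral for Gamma at \<open>1 + ?s\<close>, with
    exponent \<open>(1 + ?s) - 1 = ?s\<close>.\<close>
  also have "\<dots> = ennreal (Gamma (1 + ?s)) * ?V"
  proof (subst nn_integral_multc)
    show "(\<integral>\<^sup>+t. ennreal (indicator {0..} t * t powr ?s / exp t) \<partial>lborel) * ?V =
        ennreal (Gamma (1 + ?s)) * ?V"
      using Gamma_conv_nn_integral_real[of "1 + ?s"] by (simp add: add_nonneg_pos add_pos_nonneg)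
  qed simp
  finally show ?thesis .
qed

lemma bounded_sublevel_homogeneous:
  fixes p :: "'a::euclidean_space \<Rightarrow> real"
  assumes cont: "continuous_on UNIV p"
    and hom: "\<And>c x. p (c *\<^sub>R x) = c ^ d * p x"
    and pos: "\<And>x. x \<noteq> 0 \<Longrightarrow> p x > 0"
    and "d > 0"
  shows "bounded {x. p x \<le> t}"
proof -
  have "sphere (0::'a) 1 \<noteq> {}" by simp
  then obtain u where u: "norm u = 1" and min: "\<And>y. norm y = 1 \<Longrightarrow> p u \<le> p y"
    using continuous_attains_inf[OF compact_sphere _ continuous_on_subset[OF cont subset_UNIV]]
    by (metis mem_sphere_0)
  have "p u > 0" using u pos[of u] by fastforce
  show ?thesis
  proof (rule boundedI)
    fix x assume "x \<in> {x. p x \<le> t}"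
    then have x: "p x \<le> t" by simp
    \<comment> \<open>Outside the unit ball \<open>norm x \<le> norm x ^ d\<close>, so the minimum
      \<open>p u\<close> on the sphere gives the linear bound \<open>norm x * p u \<le> p x\<close>
      and no root has to be taken. The 1 in the maximum covers the ball itself.\<close>
    show "norm x \<le> max 1 (t / p u)"
    proof (cases "norm x \<le> 1")
      case False
      then have "x \<noteq> 0" by auto
      have "norm x * p u \<le> norm x ^ d * p u"
        using False \<open>d > 0\<close> \<open>p u > 0\<close> self_le_power[of "norm x" d] by simp
      also have "\<dots> \<le> norm x ^ d * p (x /\<^sub>R norm x)"
        using min[of "x /\<^sub>R norm x"] \<open>x \<noteq> 0\<close> by (simp add: mult_left_mono)
      also have "\<dots> = p x"
        using hom[of "norm x" "x /\<^sub>R norm x"] \<open>x \<noteq> 0\<close> by simp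
      finally show ?thesis
        using x \<open>p u > 0\<close> by (simp add: le_max_iff_disj pos_le_divide_eq)
    qed auto
  qed
qed

lemma continuous_on_mon_vec: "continuous_on UNIV (mon_vec e)"
  unfolding mon_vec_def by (auto intro!: continuous_intros)

lemma mon_vec_scaleR:
  assumes "monomial_order k e"
  shows "mon_vec e (c *\<^sub>R x) = c ^ k *\<^sub>R mon_vec e x"
proof -
  have "(\<Sum>i\<in>UNIV. e j i) = k" for j
    using assms by (auto simp: monomial_order_def bij_betw_def exponents_def)
  then show ?thesis
    by (simp add: mon_vec_def vec_eq_iff power_mult_distrib prod.distrib power_sum[symmetric])
qed

text \<open>If coordinate \<open>i\<close> of \<open>x\<close> is nonzero, so is the pure power of
  degree \<open>k\<close> in that coordinate, which occurs among the monomials because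
  \<open>e\<close> is onto. This makes the form of a positive definite \<open>G\<close> positive
  away from the origin.\<close>

lemma mon_vec_nonzero:
  fixes e :: "'m::finite \<Rightarrow> 'n::finite \<Rightarrow> nat"
  assumes "monomial_order k e" and "x \<noteq> 0"
  shows "mon_vec e x \<noteq> 0"
proof -
  obtain i where i: "x $ i \<noteq> 0" using \<open>x \<noteq> 0\<close> by (auto simp: vec_eq_iff)
  have "(\<lambda>l. if l = i then k else 0) \<in> exponents k"
    by (simp add: exponents_def)
  also have "exponents k = range e"
    using assms(1) by (simp add: monomial_order_def bij_betw_def)
  finally obtain j where j: "e j = (\<lambda>l. if l = i then k else 0)"
    by (metis imageE)
  have "mon_vec e x $ j \<noteq> 0"
    using i by (auto simp: mon_vec_def j)
  then show ?thesis by auto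
qed

lemma trace_Theta_sos: "trace (Theta_sos e l ** G) = mon_vec e l \<bullet> (G *v mon_vec e l)"
proof -
  have "trace (Theta_sos e l ** G) =
      (\<Sum>i\<in>UNIV. \<Sum>k\<in>UNIV. mon_vec e l $ i * mon_vec e l $ k * G $ k $ i)"
    by (simp add: trace_def matrix_matrix_mult_def Theta_sos_def)
  also have "\<dots> = (\<Sum>k\<in>UNIV. \<Sum>i\<in>UNIV. mon_vec e l $ i * mon_vec e l $ k * G $ k $ i)"
    by (rule sum.swap)
  finally show ?thesis
    by (simp add: inner_vec_def matrix_vector_mult_def sum_distrib_left mult_ac)
qed

text \<open>The first three conjuncts rule out default values: \<open>measure\<close> is 0 on sets
  of infinite measure, and the Bochner integral is 0 for non-integrable functions.\<close>

theorem theorem2p8: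
  fixes d :: nat
    and e :: "'m::finite \<Rightarrow> 'n::finite \<Rightarrow> nat"
  assumes "d \<ge> 2" and "even d"
    and "monomial_order (d div 2) e"
  shows "\<forall>G\<in>PD.
      emeasure lborel (sos_sublevel e G) < \<infinity> \<and> 0 < f_sos e G \<and>
      integrable (mu_sos e)
        (\<lambda>\<Theta>. exp (- trace (\<Theta> ** G)) / Gamma (1 + real CARD('n) / real d)) \<and>
      f_sos e G =
        (\<integral>\<Theta>. exp (- trace (\<Theta> ** G)) / Gamma (1 + real CARD('n) / real d) \<partial>mu_sos e)"
proof
  fix G :: "real ^ 'm ^ 'm"
  assume "G \<in> PD"
  define p where "p x = mon_vec e x \<bullet> (G *v mon_vec e x)" for x
  define \<gamma> where "\<gamma> = Gamma (1 + real CARD('n) / real d)"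
  have "d > 0" using \<open>d \<ge> 2\<close> by simp
  have "\<gamma> > 0" by (simp add: \<gamma>_def add_pos_nonneg)
  have level: "sos_sublevel e G = {x. p x \<le> 1}"
    by (simp add: sos_sublevel_def p_def)
  have cont: "continuous_on UNIV p"
    unfolding p_def
    by (intro continuous_intros continuous_on_mon_vec
        linear_continuous_on_compose[OF continuous_on_mon_vec])
      (simp add: matrix_vector_mul_linear)
  then have meas [measurable]: "p \<in> borel_measurable borel"
    by (rule borel_measurable_continuous_onI)
  have hom: "p (c *\<^sub>R x) = c ^ d * p x" for c x
  proof -
    have "c ^ (d div 2) * c ^ (d div 2) = c ^ d"
      using \<open>even d\<close> by (simp add: power_add[symmetric] mult_2[symmetric])
    then show ?thesis
      by (simp add: p_def mon_vec_scaleR[OF assms(3)] matrix_vector_mult_scaleR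
          mult.assoc[symmetric])
  qed
  have pos: "p x > 0" if "x \<noteq> 0" for x
    using \<open>G \<in> PD\<close> mon_vec_nonzero[OF assms(3) that] by (simp add: p_def PD_def)
  \<comment> \<open>Homogeneity with \<open>c = 0\<close>; the degree must be positive, since
    \<open>0 ^ 0 = 1\<close>.\<close>
  have p0: "p 0 = 0"
    using hom[of 0 0] \<open>d > 0\<close> by (simp add: power_0_left)
  then have nonneg: "0 \<le> p x" for x
    using pos[of x] by (cases "x = 0") auto
  have finite: "emeasure lborel {x. p x \<le> 1} < \<infinity>"
    by (rule emeasure_bounded_finite[OF bounded_sublevel_homogeneous[OF cont hom pos \<open>d > 0\<close>]])
  then have vol: "emeasure lborel {x. p x \<le> 1} = ennreal (f_sos e G)"
    by (simp add: f_sos_def level emeasure_eq_ennreal_measure)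
  have vol_pos: "0 < f_sos e G"
  proof -
    \<comment> \<open>The strict sublevel set is open and contains the origin, hence a ball of
      positive volume.\<close>
    have "open {x. p x < 1}"
      by (intro open_Collect_less cont continuous_on_const)
    then obtain r where r: "r > 0" "ball 0 r \<subseteq> {x. p x < 1}"
      using p0 by (metis mem_Collect_eq open_contains_ball zero_less_one)
    have "0 < emeasure lborel (ball (0 :: real ^ 'n) r)"
      using r(1) by (simp add: emeasure_ball)
    also have "\<dots> \<le> emeasure lborel {x. p x \<le> 1}"
      using r(2) by (intro emeasure_mono) (auto simp: subset_iff less_imp_le)
    finally show ?thesis
      by (simp add: vol)
  qed
  \<comment> \<open>Computed as a nonnegative integral first: its finite value later yields
    integrability and the Bochner integral together.\<close>
  have integral: "(\<integral>\<^sup>+x. ennreal (exp (- p x) / \<gamma>) \<partial>lborel) = ennreal (f_sos e G)"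
  proof -
    have "(\<integral>\<^sup>+x. ennreal (exp (- p x) / \<gamma>) \<partial>lborel) =
        (\<integral>\<^sup>+x. ennreal (1 / \<gamma>) * ennreal (exp (- p x)) \<partial>lborel)"
      using \<open>\<gamma> > 0\<close> by (simp add: ennreal_mult'[symmetric])
    also have "\<dots> = ennreal (1 / \<gamma>) * (\<integral>\<^sup>+x. ennreal (exp (- p x)) \<partial>lborel)"
      by (rule nn_integral_cmult) simp
    also have "\<dots> = ennreal (1 / \<gamma>) * (ennreal \<gamma> * ennreal (f_sos e G))"
      by (simp add: nn_integral_exp_minus_homogeneous[OF meas hom nonneg \<open>d > 0\<close>] vol \<gamma>_def)
    also have "\<dots> = ennreal (f_sos e G)"
      using \<open>\<gamma> > 0\<close> vol_pos by (simp add: ennreal_mult'[symmetric])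
    finally show ?thesis .
  qed
  define F where "F \<Theta> = exp (- trace (\<Theta> ** G)) / \<gamma>" for \<Theta> :: "real ^ 'm ^ 'm"
  have F_Theta: "F (Theta_sos e x) = exp (- p x) / \<gamma>" for x
    by (simp add: F_def trace_Theta_sos p_def)
  \<comment> \<open>Continuity on all matrices gives Borel measurability, which then restricts to
    the trace sigma-algebra on \<open>PSD\<close> carried by \<open>mu_sos e\<close>.\<close>
  have "continuous_on UNIV F"
    using \<open>\<gamma> > 0\<close> unfolding F_def trace_def matrix_matrix_mult_def
    by (auto intro!: continuous_intros)
  then have F_meas: "F \<in> borel_measurable (restrict_space borel PSD)"
    by (intro measurable_restrict_space1 borel_measurable_continuous_onI)
  have "has_bochner_integral lborel (\<lambda>x. F (Theta_sos e x)) (f_sos e G)"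
    using \<open>\<gamma> > 0\<close> vol_pos integral unfolding F_Theta
    by (intro has_bochner_integral_nn_integral) auto
  then have "has_bochner_integral (mu_sos e) F (f_sos e G)"
    unfolding mu_sos_def by (rule has_bochner_integral_distr[OF F_meas measurable_Theta_sos])
  then have "integrable (mu_sos e) F" and "f_sos e G = (\<integral>\<Theta>. F \<Theta> \<partial>mu_sos e)"
    by (simp_all add: has_bochner_integral_iff)
  then show "emeasure lborel (sos_sublevel e G) < \<infinity> \<and> 0 < f_sos e G \<and>
      integrable (mu_sos e)
        (\<lambda>\<Theta>. exp (- trace (\<Theta> ** G)) / Gamma (1 + real CARD('n) / real d)) \<and>
      f_sos e G =
        (\<integral>\<Theta>. exp (- trace (\<Theta> ** G)) / Gamma (1 + real CARD('n) / real d) \<partial>mu_sos e)"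
    using finite vol_pos unfolding level F_def \<gamma>_def by blast
qed

end
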